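(* Let $a$ be an integer, $n$ an even nonnegative integer, and $q$ an odd prime power such that $a\ne 0$ in $\mathbb{F}_q$. Then $$S_q(D_n(x,a))\in\left\{0,\ a^{n/2},\ -a^{n/2},\ 2a^{n/2},\ -2a^{n/2}\right\}\subseteq\mathbb{F}_q.$$
   Context: The Dickson polynomials are defined by $D_0(x,a)=2$, $D_1(x,a)=x$, and $D_n(x,a)=xD_{n-1}(x,a)-aD_{n-2}(x,a)$ for $n\ge 2$. For an integral polynomial $f$, $\mathfrak{R}_q(f)\subseteq\mathbb{F}_q$ is the set of values taken by $f$ on $\mathbb{F}_q$, and $S_q(f)=\sum_{y\in\mathfrak{R}_q(f)}y\in\mathbb{F}_q$ is the sum of the distinct values. The integer $a$ is also viewed as an element of $\mathbb{F}_q$ via its image. *)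

theory Defs
  imports "HOL-Computational_Algebra.Computational_Algebra" "HOL-Library.Cardinality"
begin

fun dickson :: "nat \<Rightarrow> int \<Rightarrow> int poly" where
  "dickson 0 a = [:2:]"
| "dickson (Suc 0) a = [:0, 1:]"
| "dickson (Suc (Suc n)) a = [:0, 1:] * dickson (Suc n) a - smult a (dickson n a)"

text \<open>The field with \<open>q\<close> elements is the type \<open>'a\<close>. The coefficients of \<open>f\<close> are mapped
  into it by the canonical homomorphism, and the result is evaluated as a polynomial function.\<close>

definition value_set :: "int poly \<Rightarrow> 'a::finite_field set" where
  "value_set f = range (poly (map_poly of_int f))"

definition value_sum :: "int poly \<Rightarrow> 'a::finite_field" where
  "value_sum f = (\<Sum>y\<in>value_set f. y)"

end

theory Submission
  imports "HOL-Algebra.Algebraic_Closure_Type" "HOL-Number_Theory.Residues" Defs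
begin

text \<open>
  Write \<open>A\<close> for the image of \<open>a\<close> in the algebraic closure and \<open>c = A ^ (n div 2)\<close>. Every element
  of the field is \<open>y + A / y\<close> with \<open>y ^ q = y\<close> or \<open>y ^ (q + 1) = A\<close>, and the Dickson polynomial maps
  it to \<open>u + c\<^sup>2 / u\<close> with \<open>u = y ^ n\<close>. The two kinds of \<open>u\<close> form sets \<open>H1\<close> and \<open>H2\<close> that are cosets
  of multiplicative groups, so each sums to \<open>0\<close> unless it is a singleton, necessarily \<open>{c}\<close> or \<open>{- c}\<close>.
  Two elements \<open>u\<close> give the same value iff they are exchanged by the involution \<open>u \<mapsto> c\<^sup>2 / u\<close>, whose
  fixed points are \<open>\<plusminus> c\<close>; hence the sum of the distinct values is \<open>\<Sum>(H1 \<union> H2)\<close> plus the sum of the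
  fixed points in \<open>H1 \<union> H2\<close>. As \<open>H1 \<inter> H2 \<subseteq> {c, - c}\<close>, this is a small multiple of \<open>c\<close>.
\<close>

section \<open>Dickson polynomials at \<open>y + a / y\<close>\<close>

text \<open>The elements \<open>y\<close> and \<open>a / y\<close> have sum \<open>y + a / y\<close>
  and product \<open>a\<close>, so their power sums obey the Dickson recurrence with the same
  initial values.\<close>

lemma poly_map_poly_dickson_add_divide:
  fixes y :: "'a::field"
  assumes "y \<noteq> 0"
  shows "poly (map_poly of_int (dickson n a)) (y + of_int a / y) = y ^ n + of_int a ^ n / y ^ n"
proof (induction n a rule: dickson.induct)
  case (3 n a)
  have "map_poly of_int (dickson (Suc (Suc n)) a) =
      pCons 0 (map_poly of_int (dickson (Suc n) a)) -
      smult (of_int a) (map_poly (of_int :: int \<Rightarrow> 'a) (dickson n a))"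
    by (rule poly_eqI) (auto simp: coeff_map_poly coeff_pCons split: nat.splits)
  then have rec: "poly (map_poly of_int (dickson (Suc (Suc n)) a)) x =
      x * poly (map_poly of_int (dickson (Suc n) a)) x -
      of_int a * poly (map_poly of_int (dickson n a)) x" for x :: 'a
    by (simp only: poly_diff poly_pCons poly_smult) simp
  \<comment> \<open>The induction step as a field identity, with \<open>p\<close> for
    \<open>y ^ n\<close> and \<open>r\<close> for \<open>A ^ n\<close>.\<close>
  have id: "(y + A / y) * (y * p + A * r / (y * p)) - A * (p + r / p) =
      y * (y * p) + A * (A * r) / (y * (y * p))" if "p \<noteq> 0" for p r A
    using that assms by (simp add: field_simps)
  show ?case
    unfolding rec 3 by (simp add: id[of "y ^ n"] assms)
qed (use assms in \<open>simp_all add: map_poly_pCons\<close>)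

lemma to_ac_poly_map_poly_of_int:
  "to_ac (poly (map_poly of_int f) x) = poly (map_poly of_int f) (to_ac x)"
  by (induction f) (simp_all add: map_poly_pCons)

section \<open>The \<open>q\<close>-th power map on the algebraic closure\<close>

text \<open>
  The polynomial \<open>(X + 1)\<^sup>q - X\<^sup>q - 1\<close> has degree less than \<open>q\<close> and vanishes on the whole field, so its
  coefficients are zero. This gives additivity of the \<open>q\<close>-th power without knowing that \<open>q\<close> is a
  power of the characteristic.
\<close>
lemma of_nat_binomial_CARD_eq_0:
  assumes "0 < k" "k < CARD('a::finite_field)"
  shows "(of_nat (CARD('a) choose k) :: 'a) = 0"
proof -
  define q where "q = CARD('a)"
  have q: "q > 0"
    using assms by (simp add: q_def)
  define R :: "'a poly" where "R = (\<Sum>k\<in>{1..<q}. monom (of_nat (q choose k)) k)"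
  have "R = 0"
  proof (rule poly_eqI_degree[where A = UNIV])
    show "poly R x = poly 0 x" for x
    proof -
      have "{..q} = insert 0 (insert q {1..<q})"
        using q by auto
      then have "(x + 1) ^ q = 1 + (x ^ q + poly R x)"
        using q by (simp add: binomial_ring R_def poly_sum poly_monom)
      then show ?thesis
        by (simp add: q_def finite_field_power_card_eq_same)
    qed
    have "degree R \<le> q - 1"
      unfolding R_def by (intro degree_sum_le) (auto intro!: order.trans[OF degree_monom_le])
    then show "degree R < CARD('a)"
      using q unfolding q_def by linarith
  qed (use q in \<open>simp add: q_def\<close>)
  then have "coeff R k = 0"
    by simp
  then show ?thesis
    using assms by (simp add: R_def coeff_sum q_def)
qed

text \<open>The inner binomial coefficients vanish in the base field, hence also in its
  closure.\<close>

lemma alg_closure_power_CARD_add: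
  fixes x y :: "'a::finite_field alg_closure"
  shows "(x + y) ^ CARD('a) = x ^ CARD('a) + y ^ CARD('a)"
proof -
  define q where "q = CARD('a)"
  have q: "q > 0"
    by (simp add: q_def)
  have "(of_nat (q choose k) :: 'a alg_closure) = 0" if "k \<in> {1..<q}" for k
    using that of_nat_binomial_CARD_eq_0[of k, where 'a = 'a]
    by (metis One_nat_def Suc_le_eq atLeastLessThan_iff q_def to_ac_0 to_ac_of_nat)
  moreover have "{..q} = insert 0 (insert q {1..<q})"
    using q by auto
  ultimately show ?thesis
    using q by (simp add: binomial_ring flip: q_def)
qed

lemma finite_power_eq:
  fixes c :: "'a::idom"
  assumes "n > 0"
  shows "finite {x. x ^ n = c}"
proof -
  have "coeff (monom 1 n - [:c:]) n = 1"
    using assms by (cases n) auto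
  then have "monom 1 n - [:c:] \<noteq> 0"
    by (metis coeff_0 zero_neq_one)
  from poly_roots_finite[OF this] show ?thesis
    by (simp add: poly_monom)
qed

text \<open>The \<open>q\<close> elements of the field are roots of \<open>X ^ q - X\<close>, which
  has at most \<open>q\<close> roots.\<close>

lemma range_to_ac_finite_field:
  "range (to_ac :: 'a::finite_field \<Rightarrow> _) = {x. x ^ CARD('a) = x}"
proof (rule card_seteq)
  define q where "q = CARD('a)"
  define P :: "'a alg_closure poly" where "P = monom 1 q - monom 1 1"
  \<comment> \<open>The bound \<open>q \<ge> 2\<close> keeps the two monomials of \<open>P\<close>
    from cancelling.\<close>
  have "card {0, 1 :: 'a} \<le> CARD('a)"
    by (rule card_mono) auto
  then have q: "q \<ge> 2"
    by (simp add: q_def)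
  have "coeff P q = 1"
    using q by (auto simp: P_def)
  then have P: "P \<noteq> 0"
    by (metis coeff_0 zero_neq_one)
  have roots: "{x. x ^ CARD('a) = x} = {x. poly P x = 0}"
    by (simp add: P_def poly_monom q_def)
  show "finite {x :: 'a alg_closure. x ^ CARD('a) = x}"
    using poly_roots_finite[OF P] roots by simp
  have "card {x. poly P x = 0} \<le> degree P"
    by (rule card_poly_roots_bound[OF P])
  also have "degree P \<le> q"
    unfolding P_def using q
    by (intro degree_diff_le) (auto intro!: order.trans[OF degree_monom_le])
  also have "q = card (range (to_ac :: 'a \<Rightarrow> _))"
    by (simp add: card_image inj_to_ac q_def)
  finally show "card {x :: 'a alg_closure. x ^ CARD('a) = x} \<le> card (range (to_ac :: 'a \<Rightarrow> _))"
    using roots by simp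
  show "range (to_ac :: 'a \<Rightarrow> _) \<subseteq> {x. x ^ CARD('a) = x}"
    by (auto simp: finite_field_power_card_eq_same simp flip: to_ac_power)
qed

section \<open>Parametrising the field by \<open>y + A / y\<close>\<close>

lemma add_divide_eq_iff_quadratic:
  fixes x y a :: "'a::field"
  assumes "y \<noteq> 0"
  shows "x = y + a / y \<longleftrightarrow> y * (x - y) = a"
  using assms by (auto simp: field_simps)

text \<open>The difference of the two values is
  \<open>(u - v) * (u * v - d) / (u * v)\<close>.\<close>

lemma add_divide_eq_add_divide_iff:
  fixes u v d :: "'a::field"
  assumes "u \<noteq> 0" "v \<noteq> 0"
  shows "u + d / u = v + d / v \<longleftrightarrow> u = v \<or> u = d / v"
proof -
  have "(u + d / u - (v + d / v)) * (u * v) = (u - v) * (u * v - d)"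
    using assms by (simp add: field_simps)
  then have "u + d / u = v + d / v \<longleftrightarrow> u = v \<or> u * v = d"
    using assms by (metis eq_iff_diff_eq_0 mult_eq_0_iff)
  then show ?thesis
    using assms by (auto simp: field_simps)
qed

text \<open>For \<open>x\<close> in the base field, the \<open>q\<close>-th power map permutes the
  roots \<open>y\<close> and \<open>A / y\<close> of \<open>T ^ 2 - x * T + A\<close>, so it fixes
  or swaps them. Conversely, either behaviour makes their sum a fixed point of that map.\<close>

lemma range_to_ac_eq_add_divide:
  fixes A :: "'a::finite_field alg_closure"
  assumes A: "A \<in> range to_ac" "A \<noteq> 0"
  shows "range to_ac =
    (\<lambda>y. y + A / y) ` {y. y \<noteq> 0 \<and> (y ^ CARD('a) = y \<or> y ^ Suc (CARD('a)) = A)}"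
proof (intro equalityI subsetI)
  define q where "q = CARD('a)"
  have Aq: "A ^ q = A"
    using A(1) unfolding range_to_ac_finite_field q_def by simp
  fix x :: "'a alg_closure"
  {
    assume "x \<in> range to_ac"
    then have xq: "x ^ q = x"
      unfolding range_to_ac_finite_field q_def by simp
    obtain y where "poly [:A, -x, 1:] y = 0"
      using alg_closed_imp_poly_has_root[of "[:A, -x, 1:]"] by auto
    then have y: "y * (x - y) = A"
      by (simp add: algebra_simps)
    then have y0: "y \<noteq> 0"
      using A(2) by auto
    \<comment> \<open>The \<open>q\<close>-th power of the equation for \<open>y\<close> shows that
      \<open>y ^ q\<close> is a root of the same quadratic.\<close>
    have "y ^ q * (x - y) ^ q = A"
      using y Aq by (metis power_mult_distrib)
    moreover have "(x - y) ^ q = x - y ^ q"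
      using alg_closure_power_CARD_add[of "x - y" y] xq by (simp add: q_def algebra_simps)
    ultimately have "y ^ q * (x - y ^ q) = A"
      by simp
    then have "y + A / y = y ^ q + A / y ^ q"
      using y y0 add_divide_eq_iff_quadratic[of y x A] add_divide_eq_iff_quadratic[of "y ^ q" x A]
      by simp
    then have "y = y ^ q \<or> y = A / y ^ q"
      using y0 by (simp add: add_divide_eq_add_divide_iff)
    then have "y ^ q = y \<or> y ^ Suc q = A"
      using y0 by (auto simp: field_simps)
    moreover have "x = y + A / y"
      using y y0 add_divide_eq_iff_quadratic by blast
    ultimately show "x \<in> (\<lambda>y. y + A / y) `
        {y. y \<noteq> 0 \<and> (y ^ CARD('a) = y \<or> y ^ Suc (CARD('a)) = A)}"
      using y0 by (auto simp: q_def)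
  next
    assume "x \<in> (\<lambda>y. y + A / y) `
        {y. y \<noteq> 0 \<and> (y ^ CARD('a) = y \<or> y ^ Suc (CARD('a)) = A)}"
    then obtain y where y: "y \<noteq> 0" "y ^ q = y \<or> y ^ Suc q = A" and x: "x = y + A / y"
      by (auto simp: q_def)
    have "x ^ q = y ^ q + A / y ^ q"
      using Aq alg_closure_power_CARD_add[of y "A / y"]
      by (simp add: x q_def power_divide)
    moreover have "y ^ q = y \<or> y ^ q = A / y"
      using y by (auto simp: field_simps)
    ultimately have "x ^ q = x"
      using y A(2) by (auto simp: x)
    then show "x \<in> range to_ac"
      unfolding range_to_ac_finite_field q_def by simp
  }
qed

section \<open>Sums of distinct values and sums over cosets\<close>

text \<open>A two-element fibre \<open>{u, d / u}\<close> contributes exactly its value to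
  \<open>\<Sum>H\<close>. A fixed point has value \<open>2 * u\<close>, so it must be counted once
  more.\<close>

lemma sum_image_add_divide:
  fixes d :: "'a::field"
  assumes "finite H" "0 \<notin> H" "d \<noteq> 0" and closed: "\<And>u. u \<in> H \<Longrightarrow> d / u \<in> H"
  shows "\<Sum>((\<lambda>u. u + d / u) ` H) = \<Sum>H + \<Sum>{u \<in> H. u\<^sup>2 = d}"
proof -
  define f where "f u = u + d / u" for u
  define g where "g u = u + (if u\<^sup>2 = d then u else 0)" for u
  have "\<Sum>H + \<Sum>{u \<in> H. u\<^sup>2 = d} = sum g H"
    using assms(1) by (simp add: g_def sum.distrib sum.inter_filter)
  also have "\<dots> = (\<Sum>v\<in>f ` H. sum g {u \<in> H. f u = v})"
    by (rule sum.image_gen[OF assms(1)])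
  also have "\<dots> = \<Sum>(f ` H)"
  proof (rule sum.cong)
    fix v assume "v \<in> f ` H"
    then obtain w where w: "w \<in> H" "v = f w"
      by auto
    have w0: "w \<noteq> 0"
      using w assms(2) by auto
    have "f u = v \<longleftrightarrow> u = w \<or> u = d / w" if "u \<in> H" for u
      using that w w0 assms(2) add_divide_eq_add_divide_iff[of u w d] by (auto simp: f_def)
    then have fibre: "{u \<in> H. f u = v} = {w, d / w}"
      using w closed by auto
    show "sum g {u \<in> H. f u = v} = v"
    proof (cases "w\<^sup>2 = d")
      case True
      then have "d / w = w"
        using w0 by (auto simp: power2_eq_square)
      then show ?thesis
        unfolding fibre using True w by (simp add: g_def f_def)
    next
      case False
      then have "d / w \<noteq> w" "(d / w)\<^sup>2 \<noteq> d"
        using w0 assms(3) by (auto simp: field_simps power2_eq_square)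
      then show ?thesis
        unfolding fibre using False w by (simp add: g_def f_def)
    qed
  qed simp
  finally show ?thesis
    by (simp add: f_def)
qed

text \<open>Multiplication by a ratio \<open>u / v\<close> other than 1 permutes \<open>H\<close>,
  so the sum equals \<open>u / v\<close> times itself.\<close>

lemma sum_coset_eq_0_or_singleton:
  fixes H :: "'a::field set"
  assumes "0 \<notin> H" "finite H"
    and closed: "\<And>u v w. u \<in> H \<Longrightarrow> v \<in> H \<Longrightarrow> w \<in> H \<Longrightarrow> u / v * w \<in> H"
  shows "\<Sum>H = 0 \<or> (\<exists>b. H = {b})"
proof (cases "\<exists>u\<in>H. \<exists>v\<in>H. u \<noteq> v")
  case True
  then obtain u v where uv: "u \<in> H" "v \<in> H" "u \<noteq> v"
    by auto
  then have nz: "u \<noteq> 0" "v \<noteq> 0"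
    using assms(1) by auto
  have "\<Sum>H = (\<Sum>w\<in>H. u / v * w)"
  proof (rule sum.reindex_bij_witness[of _ "\<lambda>w. u / v * w" "\<lambda>w. v / u * w"])
    show "v / u * w \<in> H" "u / v * w \<in> H" if "w \<in> H" for w
      using closed uv that by blast+
  qed (use nz in simp_all)
  also have "\<dots> = u / v * \<Sum>H"
    by (rule sum_distrib_left[symmetric])
  finally have "u / v = 1 \<or> \<Sum>H = 0"
    by (metis mult_cancel_right1)
  then show ?thesis
    using uv nz by (elim disjE) (simp, rule disjI1)
next
  case False
  then show ?thesis
    by (metis is_singletonI' is_singleton_def sum.empty)
qed

text \<open>In a singleton, the only element is fixed by the involution, so its square is
  \<open>c\<^sup>2\<close>.\<close>

lemma sum_coset_cases:
  fixes H :: "'a::field set"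
  assumes "0 \<notin> H" "finite H"
    and "\<And>u v w. u \<in> H \<Longrightarrow> v \<in> H \<Longrightarrow> w \<in> H \<Longrightarrow> u / v * w \<in> H"
    and "\<And>u. u \<in> H \<Longrightarrow> c\<^sup>2 / u \<in> H"
  shows "\<Sum>H = 0 \<or> H = {c} \<or> H = {- c}"
proof -
  have "b = c \<or> b = - c" if "H = {b}" for b
  proof -
    have "b \<noteq> 0" "c\<^sup>2 / b = b"
      using assms(1) assms(4)[of b] that by auto
    then have "b\<^sup>2 = c\<^sup>2"
      by (simp add: field_simps power2_eq_square)
    then show ?thesis
      by (simp add: power2_eq_iff)
  qed
  then show ?thesis
    using sum_coset_eq_0_or_singleton[OF assms(1-3)] by blast
qed

text \<open>Each of \<open>c\<close> and \<open>- c\<close> is added if it lies in the union and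
  subtracted if it lies in the intersection. Hence it corrects \<open>\<Sum>H1 + \<Sum>H2\<close>
  only when it lies in exactly one of the two sets.\<close>

lemma sum_Un_plus_fixed_points:
  fixes c :: "'a::field"
  assumes fin: "finite H1" "finite H2" and c: "c \<noteq> - c"
    and int: "H1 \<inter> H2 \<subseteq> {c, - c}"
    and H1: "\<Sum>H1 = 0 \<or> H1 = {c} \<or> H1 = {- c}"
    and H2: "\<Sum>H2 = 0 \<or> H2 = {c} \<or> H2 = {- c}"
  shows "\<Sum>(H1 \<union> H2) + \<Sum>{u \<in> H1 \<union> H2. u\<^sup>2 = c\<^sup>2} \<in> {0, c, - c, 2 * c, - (2 * c)}"
proof -
  have pm: "\<Sum>{u \<in> S. u = c \<or> u = - c} = (if c \<in> S then c else 0) + (if - c \<in> S then - c else 0)"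
    for S
  proof -
    have "{u \<in> S. u = c \<or> u = - c} = (if c \<in> S then {c} else {}) \<union> (if - c \<in> S then {- c} else {})"
      by auto
    then show ?thesis
      using c by auto
  qed
  have "H1 \<inter> H2 = {u \<in> H1 \<inter> H2. u = c \<or> u = - c}"
    using int by auto
  then have "\<Sum>(H1 \<inter> H2) =
      (if c \<in> H1 \<inter> H2 then c else 0) + (if - c \<in> H1 \<inter> H2 then - c else 0)"
    using pm[of "H1 \<inter> H2"] by simp
  moreover have "{u \<in> H1 \<union> H2. u\<^sup>2 = c\<^sup>2} = {u \<in> H1 \<union> H2. u = c \<or> u = - c}"
    by (simp add: power2_eq_iff)
  ultimately have eq: "\<Sum>(H1 \<union> H2) + \<Sum>{u \<in> H1 \<union> H2. u\<^sup>2 = c\<^sup>2} =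
      \<Sum>H1 + \<Sum>H2 + (if (c \<in> H1) = (c \<in> H2) then 0 else c)
        + (if (- c \<in> H1) = (- c \<in> H2) then 0 else - c)"
    using fin by (simp add: sum_Un pm[of "H1 \<union> H2"] del: Un_iff) auto
  show ?thesis
    unfolding eq using H1 H2 c by (elim disjE) (auto split: if_splits)
qed

section \<open>Odd characteristic and the sum of the Dickson values\<close>

lemma two_neq_0_of_odd_CARD:
  assumes "odd (CARD('a::finite_field))"
  shows "(2 :: 'a) \<noteq> 0"
proof
  assume "(2 :: 'a) = 0"
  then have "(of_nat 2 :: 'a) = 0"
    by simp
  then have "CHAR('a) dvd 2"
    by (simp only: of_nat_eq_0_iff_char_dvd)
  then have "CHAR('a) = 2"
    by (metis CHAR_prime primes_dvd_imp_eq two_is_prime_nat)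
  then show False
    using assms CHAR_dvd_CARD[where 'a = 'a] by simp
qed

theorem corollary1p3:
  fixes a :: int and n q :: nat
  assumes "even n"
    and "CARD('a::finite_field) = q"
    and "odd q"
    and "(of_int a :: 'a) \<noteq> 0"
  shows "(value_sum (dickson n a) :: 'a) \<in>
    {0, of_int a ^ (n div 2), - (of_int a ^ (n div 2)),
     2 * of_int a ^ (n div 2), - (2 * of_int a ^ (n div 2))}"
proof -
  define A :: "'a alg_closure" where "A = of_int a"
  define c where "c = A ^ (n div 2)"
  have A: "A = to_ac (of_int a)"
    by (simp add: A_def)
  have A0: "A \<noteq> 0"
    unfolding A using assms(4) by (simp del: to_ac_of_int)
  have Ar: "A \<in> range to_ac"
    unfolding A by (rule rangeI)
  then have Aq: "A ^ q = A"
    using assms(2) unfolding range_to_ac_finite_field by simp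
  \<comment> \<open>Evenness of \<open>n\<close> enters here.\<close>
  have c2: "c\<^sup>2 = A ^ n"
    using assms(1) by (simp add: c_def flip: power_mult)
  have c0: "c \<noteq> 0"
    using A0 by (simp add: c_def)
  have "to_ac (2 :: 'a) \<noteq> 0"
    using two_neq_0_of_odd_CARD[where 'a = 'a] assms(2,3) by (simp del: to_ac_numeral)
  then have "2 * c \<noteq> 0"
    using c0 by simp
  then have cc: "c \<noteq> - c"
    by (metis add.right_inverse mult_2)
  \<comment> \<open>The two kinds of parameter from
    \<open>range_to_ac_eq_add_divide\<close>.\<close>
  define Y1 :: "'a alg_closure set" where "Y1 = {y. y \<noteq> 0 \<and> y ^ q = y}"
  define Y2 where "Y2 = {y. y ^ Suc q = A}"
  define H1 where "H1 = (\<lambda>y. y ^ n) ` Y1"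
  define H2 where "H2 = (\<lambda>y. y ^ n) ` Y2"
  have Y2_0: "y \<noteq> 0" if "y \<in> Y2" for y
    using that A0 by (auto simp: Y2_def)
  have nz: "0 \<notin> H1" "0 \<notin> H2"
    using Y2_0 by (auto simp: H1_def H2_def Y1_def)
  have fin: "finite H1" "finite H2"
  proof -
    have "Y1 \<subseteq> range (to_ac :: 'a \<Rightarrow> _)"
      using assms(2) unfolding range_to_ac_finite_field by (auto simp: Y1_def)
    then show "finite H1"
      unfolding H1_def by (meson finite finite_imageI finite_subset)
    show "finite H2"
      unfolding H2_def Y2_def by (intro finite_imageI finite_power_eq) simp
  qed
  have coset1: "u / v * w \<in> H1" if "u \<in> H1" "v \<in> H1" "w \<in> H1" for u v w
  proof -
    obtain x y z where xyz: "x \<in> Y1" "y \<in> Y1" "z \<in> Y1" "u = x ^ n" "v = y ^ n" "w = z ^ n"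
      using \<open>u \<in> H1\<close> \<open>v \<in> H1\<close> \<open>w \<in> H1\<close> unfolding H1_def by blast
    then show ?thesis
      unfolding H1_def
      by (intro image_eqI[of _ _ "x / y * z"])
        (auto simp: Y1_def power_mult_distrib power_divide)
  qed
  have coset2: "u / v * w \<in> H2" if "u \<in> H2" "v \<in> H2" "w \<in> H2" for u v w
  proof -
    obtain x y z where xyz: "x \<in> Y2" "y \<in> Y2" "z \<in> Y2" "u = x ^ n" "v = y ^ n" "w = z ^ n"
      using \<open>u \<in> H2\<close> \<open>v \<in> H2\<close> \<open>w \<in> H2\<close> unfolding H2_def by blast
    \<comment> \<open>Its power with exponent \<open>Suc q\<close> is
      \<open>A / A * A = A\<close>.\<close>
    then have "x / y * z \<in> Y2"
      using A0 by (simp add: Y2_def power_mult_distrib power_divide del: power_Suc)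
    then show ?thesis
      unfolding H2_def using xyz
      by (intro image_eqI[of _ _ "x / y * z"]) (auto simp: power_mult_distrib power_divide)
  qed
  have inv1: "c\<^sup>2 / u \<in> H1" if "u \<in> H1" for u
  proof -
    obtain y where y: "y \<in> Y1" "u = y ^ n"
      using \<open>u \<in> H1\<close> unfolding H1_def by blast
    then show ?thesis
      unfolding H1_def c2 using A0 Aq
      by (intro image_eqI[of _ _ "A / y"]) (auto simp: Y1_def power_divide)
  qed
  have inv2: "c\<^sup>2 / u \<in> H2" if "u \<in> H2" for u
  proof -
    obtain y where y: "y \<in> Y2" "u = y ^ n"
      using \<open>u \<in> H2\<close> unfolding H2_def by blast
    \<comment> \<open>Since \<open>A ^ q = A\<close>, the right-hand side is
      \<open>A * A / A = A\<close>.\<close>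
    have "(A / y) ^ Suc q = A * A ^ q / y ^ Suc q"
      by (simp add: power_divide)
    then have "A / y \<in> Y2"
      using y A0 Aq by (simp add: Y2_def)
    then show ?thesis
      unfolding H2_def c2 using y
      by (intro image_eqI[of _ _ "A / y"]) (auto simp: power_divide)
  qed
  have int: "H1 \<inter> H2 \<subseteq> {c, - c}"
  proof
    fix u assume "u \<in> H1 \<inter> H2"
    then obtain y z where y: "y \<in> Y1" "u = y ^ n" and z: "z \<in> Y2" "u = z ^ n"
      by (auto simp: H1_def H2_def)
    \<comment> \<open>The form \<open>y ^ n\<close> gives \<open>u ^ q = u\<close> and the form
      \<open>z ^ n\<close> gives \<open>u ^ Suc q = A ^ n\<close>; together they give
      \<open>u * u = A ^ n\<close>.\<close>
    have "u ^ q = u"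
      using y power_mult[of y n q] power_mult[of y q n] by (simp add: Y1_def mult.commute)
    moreover have "u ^ Suc q = A ^ n"
      using z power_mult[of z n "Suc q"] power_mult[of z "Suc q" n] by (simp add: Y2_def mult.commute del: power_Suc)
    ultimately have "u\<^sup>2 = c\<^sup>2"
      unfolding c2 by (simp add: power2_eq_square)
    then show "u \<in> {c, - c}"
      by (simp add: power2_eq_iff)
  qed
  have "to_ac ` value_set (dickson n a) =
      poly (map_poly of_int (dickson n a)) ` range (to_ac :: 'a \<Rightarrow> _)"
    by (simp add: value_set_def image_image to_ac_poly_map_poly_of_int)
  also have "range (to_ac :: 'a \<Rightarrow> _) = (\<lambda>y. y + A / y) ` (Y1 \<union> Y2)"
    unfolding range_to_ac_eq_add_divide[OF Ar A0] assms(2)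
    using Y2_0 by (intro arg_cong2[where f = image] refl) (auto simp: Y1_def Y2_def)
  also have "poly (map_poly of_int (dickson n a)) ` \<dots> = (\<lambda>y. y ^ n + A ^ n / y ^ n) ` (Y1 \<union> Y2)"
    unfolding image_image
  proof (rule image_cong)
    fix y assume "y \<in> Y1 \<union> Y2"
    then have "y \<noteq> 0"
      using Y2_0 by (auto simp: Y1_def)
    then show "poly (map_poly of_int (dickson n a)) (y + A / y) = y ^ n + A ^ n / y ^ n"
      unfolding A_def by (rule poly_map_poly_dickson_add_divide)
  qed simp
  also have "\<dots> = (\<lambda>u. u + c\<^sup>2 / u) ` (H1 \<union> H2)"
    by (simp add: H1_def H2_def image_Un image_image c2)
  finally have image_eq: "to_ac ` (value_set (dickson n a) :: 'a set) =
      (\<lambda>u. u + c\<^sup>2 / u) ` (H1 \<union> H2)" .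
  \<comment> \<open>Injectivity of \<open>to_ac\<close> keeps distinct values distinct, so the sum
    can be computed in the closure.\<close>
  have "to_ac (value_sum (dickson n a) :: 'a) = \<Sum>(to_ac ` value_set (dickson n a))"
    by (simp add: value_sum_def to_ac_sum sum.reindex inj_on_subset[OF inj_to_ac])
  also have "\<dots> = \<Sum>(H1 \<union> H2) + \<Sum>{u \<in> H1 \<union> H2. u\<^sup>2 = c\<^sup>2}"
    unfolding image_eq using fin nz c0 inv1 inv2 by (intro sum_image_add_divide) auto
  also have "\<dots> \<in> {0, c, - c, 2 * c, - (2 * c)}"
    using fin cc int sum_coset_cases[OF nz(1) fin(1) coset1 inv1]
      sum_coset_cases[OF nz(2) fin(2) coset2 inv2]
    by (intro sum_Un_plus_fixed_points) auto
  finally have "to_ac (value_sum (dickson n a) :: 'a) \<in>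
      to_ac ` {0, of_int a ^ (n div 2), - (of_int a ^ (n div 2)),
        2 * of_int a ^ (n div 2), - (2 * of_int a ^ (n div 2))}"
    by (simp add: c_def A_def)
  then show ?thesis
    by (simp only: inj_image_mem_iff[OF inj_to_ac])
qed

end
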